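(* Let $G$ be a finite group of order $n$, $A=(a_0,\dots,a_{n-1})$ an ordering of its elements, and $P(G,A)$ the regular anti-phase template. For $b\in\{1,\dots,n-1\}$ put $q_b=a_{b-1}a_b^{-1}$ and $H_b=\langle q_b\rangle$. Let $b\in\{1,\dots,n-1\}$, let $K\subseteq G$ be any union of left cosets of $H_b$ (possibly empty), and define $$d^{(b,K)}_g=\begin{cases} b, & g\in K,\\ b-1, & g\notin K.\end{cases}$$ Then $d^{(b,K)}$ is the index function of a stable matching $\mu^{(b,K)}$ of $P(G,A)$. Moreover $\mu^{(b,G)}=\mu_b$ and $\mu^{(b,\emptyset)}=\mu_{b-1}$, while for every such $K$ with $\emptyset\subsetneq K\subsetneq G$ the matching $\mu^{(b,K)}$ is not canonical (i.e. is not equal to any $\mu_t$, $0\le t\le n-1$). Consequently $$|\operatorname{Stab}(P(G,A))|=n\quad\Longleftrightarrow\quad \langle q_b\rangle=G\ \text{ for every } b=1,\dots,n-1.$$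
   Context: A strict complete profile consists of equally many men and women, each with a strict total order over all participants of the opposite side. A matching is a bijection $\mu$ from men to women. A pair $(m,w)$ blocks $\mu$ if $m$ prefers $w$ to $\mu(m)$ and $w$ prefers $m$ to $\mu^{-1}(w)$; $\mu$ is stable if no pair blocks it. $\operatorname{Stab}(S)$ is the set of stable matchings of a profile $S$. An ordering of $G$ is a tuple listing each element exactly once. The regular anti-phase template $P(G,A)$ is the profile with men $m_g$ and women $w_g$ indexed by $g\in G$ and lists $$m_g:\ w_{ga_0}\succ w_{ga_1}\succ\cdots\succ w_{ga_{n-1}},\qquad w_h:\ m_{ha_{n-1}^{-1}}\succ m_{ha_{n-2}^{-1}}\succ\cdots\succ m_{ha_0^{-1}}.$$ For $t=0,\dots,n-1$ the canonical matching $\mu_t$ is $\mu_t(m_g)=w_{ga_t}$ for all $g\in G$. The index function of a matching $\mu$ of $P(G,A)$ is the function $d:G\to\{0,\dots,n-1\}$ determined by $\mu(m_g)=w_{ga_{d_g}}$; a function $d$ is the index function of a matching precisely when $g\mapsto ga_{d_g}$ is a bijection of $G$. *)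

theory Defs
  imports "HOL-Algebra.Left_Coset" "HOL-Algebra.Generated_Groups" "HOL-Library.FuncSet"
begin

text \<open>
  A preference relation is a set of pairs whose first component is the preferred one:
  \<open>(w, w') \<in> man_pref S m\<close> means that \<open>m\<close> strictly prefers \<open>w\<close> to \<open>w'\<close>.
\<close>

record ('m, 'w) profile =
  men :: "'m set"
  women :: "'w set"
  man_pref :: "'m \<Rightarrow> ('w \<times> 'w) set"
  woman_pref :: "'w \<Rightarrow> ('m \<times> 'm) set"

definition strict_complete_profile :: "('m, 'w) profile \<Rightarrow> bool" where
  "strict_complete_profile S \<longleftrightarrow>
     finite (men S) \<and> finite (women S) \<and> card (men S) = card (women S) \<and>
     (\<forall>m\<in>men S. man_pref S m \<subseteq> women S \<times> women S \<and>
                 strict_linear_order_on (women S) (man_pref S m)) \<and>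
     (\<forall>w\<in>women S. woman_pref S w \<subseteq> men S \<times> men S \<and>
                 strict_linear_order_on (men S) (woman_pref S w))"

text \<open>
  Matchings are extensional (equal to \<open>undefined\<close> outside the set of men), so that distinct HOL
  functions are distinct matchings and the set of stable matchings can be counted.
\<close>

definition matchings :: "('m, 'w) profile \<Rightarrow> ('m \<Rightarrow> 'w) set" where
  "matchings S = {\<mu> \<in> extensional (men S). bij_betw \<mu> (men S) (women S)}"

definition blocks :: "('m, 'w) profile \<Rightarrow> ('m \<Rightarrow> 'w) \<Rightarrow> 'm \<Rightarrow> 'w \<Rightarrow> bool" where
  "blocks S \<mu> m w \<longleftrightarrow>
     (w, \<mu> m) \<in> man_pref S m \<and> (m, the_inv_into (men S) \<mu> w) \<in> woman_pref S w"

definition Stab :: "('m, 'w) profile \<Rightarrow> ('m \<Rightarrow> 'w) set" where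
  "Stab S = {\<mu> \<in> matchings S. \<not> (\<exists>m\<in>men S. \<exists>w\<in>women S. blocks S \<mu> m w)}"

definition is_ordering :: "('a, 'b) monoid_scheme \<Rightarrow> 'a list \<Rightarrow> bool" where
  "is_ordering G A \<longleftrightarrow> distinct A \<and> set A = carrier G"

definition list_pref :: "'a list \<Rightarrow> ('a \<times> 'a) set" where
  "list_pref xs = {(xs ! i, xs ! j) | i j. i < j \<and> j < length xs}"

text \<open>
  In the template the man \<open>m\<^sub>g\<close> and the woman \<open>w\<^sub>g\<close> are both represented by the group element
  \<open>g\<close>; the side is determined by the position in the profile.
\<close>

definition template :: "('a, 'b) monoid_scheme \<Rightarrow> 'a list \<Rightarrow> ('a, 'a) profile" where
  "template G A =
     \<lparr> men = carrier G,
       women = carrier G,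
       man_pref = (\<lambda>g. list_pref (map (\<lambda>a. g \<otimes>\<^bsub>G\<^esub> a) A)),
       woman_pref = (\<lambda>h. list_pref (rev (map (\<lambda>a. h \<otimes>\<^bsub>G\<^esub> inv\<^bsub>G\<^esub> a) A))) \<rparr>"

definition canonical :: "('a, 'b) monoid_scheme \<Rightarrow> 'a list \<Rightarrow> nat \<Rightarrow> 'a \<Rightarrow> 'a" where
  "canonical G A t = (\<lambda>g\<in>carrier G. g \<otimes>\<^bsub>G\<^esub> A ! t)"

definition is_index_function ::
    "('a, 'b) monoid_scheme \<Rightarrow> 'a list \<Rightarrow> ('a \<Rightarrow> 'a) \<Rightarrow> ('a \<Rightarrow> nat) \<Rightarrow> bool" where
  "is_index_function G A \<mu> d \<longleftrightarrow>
     d \<in> carrier G \<rightarrow>\<^sub>E {..<length A} \<and> (\<forall>g\<in>carrier G. \<mu> g = g \<otimes>\<^bsub>G\<^esub> A ! (d g))"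

definition of_index :: "('a, 'b) monoid_scheme \<Rightarrow> 'a list \<Rightarrow> ('a \<Rightarrow> nat) \<Rightarrow> 'a \<Rightarrow> 'a" where
  "of_index G A d = (\<lambda>g\<in>carrier G. g \<otimes>\<^bsub>G\<^esub> A ! (d g))"

definition q_elt :: "('a, 'b) monoid_scheme \<Rightarrow> 'a list \<Rightarrow> nat \<Rightarrow> 'a" where
  "q_elt G A b = A ! (b - 1) \<otimes>\<^bsub>G\<^esub> inv\<^bsub>G\<^esub> (A ! b)"

definition H_sub :: "('a, 'b) monoid_scheme \<Rightarrow> 'a list \<Rightarrow> nat \<Rightarrow> 'a set" where
  "H_sub G A b = generate G {q_elt G A b}"

definition union_of_left_cosets :: "('a, 'b) monoid_scheme \<Rightarrow> 'a set \<Rightarrow> 'a set \<Rightarrow> bool" where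
  "union_of_left_cosets G L K \<longleftrightarrow> (\<exists>\<C>. \<C> \<subseteq> lcosets\<^bsub>G\<^esub> L \<and> K = \<Union>\<C>)"

definition d_fun :: "('a, 'b) monoid_scheme \<Rightarrow> nat \<Rightarrow> 'a set \<Rightarrow> 'a \<Rightarrow> nat" where
  "d_fun G b K = (\<lambda>g\<in>carrier G. if g \<in> K then b else b - 1)"

definition mu_match :: "('a, 'b) monoid_scheme \<Rightarrow> 'a list \<Rightarrow> nat \<Rightarrow> 'a set \<Rightarrow> 'a \<Rightarrow> 'a" where
  "mu_match G A b K = of_index G A (d_fun G b K)"

lemma list_pref_strict_linear_order:
  assumes "distinct xs"
  shows "list_pref xs \<subseteq> set xs \<times> set xs" "strict_linear_order_on (set xs) (list_pref xs)"
proof -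
  show "list_pref xs \<subseteq> set xs \<times> set xs"
    by (auto simp: list_pref_def)
  have "trans (list_pref xs)"
    unfolding list_pref_def trans_def
    using assms by (auto simp: nth_eq_iff_index_eq)
      (metis assms less_trans nth_eq_iff_index_eq)
  moreover have "irrefl (list_pref xs)"
    using assms by (auto simp: list_pref_def irrefl_def nth_eq_iff_index_eq)
  moreover have "total_on (set xs) (list_pref xs)"
    unfolding total_on_def
  proof (intro ballI impI)
    fix x y assume "x \<in> set xs" "y \<in> set xs" "x \<noteq> y"
    then obtain i j where "i < length xs" "j < length xs" "x = xs ! i" "y = xs ! j" "i \<noteq> j"
      by (metis in_set_conv_nth)
    thus "(x, y) \<in> list_pref xs \<or> (y, x) \<in> list_pref xs"
      unfolding list_pref_def using nat_neq_iff[of i j] by blast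
  qed
  ultimately show "strict_linear_order_on (set xs) (list_pref xs)"
    by (simp add: strict_linear_order_on_def)
qed

lemma template_strict_complete_profile:
  assumes "group G" "is_ordering G A"
  shows "strict_complete_profile (template G A)"
proof -
  interpret group G by fact
  have A: "distinct A" "set A = carrier G"
    using assms by (auto simp: is_ordering_def)
  have m: "distinct (map (\<lambda>a. g \<otimes>\<^bsub>G\<^esub> a) A)" "set (map (\<lambda>a. g \<otimes>\<^bsub>G\<^esub> a) A) = carrier G"
    if g: "g \<in> carrier G" for g
  proof -
    show "distinct (map (\<lambda>a. g \<otimes>\<^bsub>G\<^esub> a) A)"
      using A g by (auto simp: distinct_map inj_on_def)
    have "x \<in> (\<lambda>a. g \<otimes>\<^bsub>G\<^esub> a) ` carrier G" if "x \<in> carrier G" for x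
      using g that by (intro image_eqI[of _ _ "inv\<^bsub>G\<^esub> g \<otimes>\<^bsub>G\<^esub> x"]) (auto simp: m_assoc[symmetric])
    thus "set (map (\<lambda>a. g \<otimes>\<^bsub>G\<^esub> a) A) = carrier G"
      using A g by auto
  qed
  have w: "distinct (rev (map (\<lambda>a. g \<otimes>\<^bsub>G\<^esub> inv\<^bsub>G\<^esub> a) A))"
      "set (rev (map (\<lambda>a. g \<otimes>\<^bsub>G\<^esub> inv\<^bsub>G\<^esub> a) A)) = carrier G"
    if g: "g \<in> carrier G" for g
  proof -
    show "distinct (rev (map (\<lambda>a. g \<otimes>\<^bsub>G\<^esub> inv\<^bsub>G\<^esub> a) A))"
      using A g by (auto simp: distinct_map inj_on_def dest: arg_cong[of _ _ "m_inv G"])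
    have "x \<in> (\<lambda>a. g \<otimes>\<^bsub>G\<^esub> inv\<^bsub>G\<^esub> a) ` carrier G" if "x \<in> carrier G" for x
      using g that by (intro image_eqI[of _ _ "inv\<^bsub>G\<^esub> x \<otimes>\<^bsub>G\<^esub> g"])
        (auto simp: m_assoc[symmetric] inv_mult_group)
    thus "set (rev (map (\<lambda>a. g \<otimes>\<^bsub>G\<^esub> inv\<^bsub>G\<^esub> a) A)) = carrier G"
      using A g by auto
  qed
  have "finite (carrier G)"
    using A by (metis List.finite_set)
  thus ?thesis
    using list_pref_strict_linear_order[OF m(1)] list_pref_strict_linear_order[OF w(1)] m(2) w(2)
    unfolding strict_complete_profile_def template_def by simp
qed

end

theory Submission
  imports Defs
begin

text \<open>
  Let \<open>d\<close> be the index function of a stable matching \<open>\<mu>\<close>, let \<open>K\<close> be the set of all \<open>g\<close> with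
  \<open>d g \<ge> b\<close>, and put \<open>L = \<mu> ` K\<close>. Stability says that no \<open>i\<close> lies strictly between the index of the
  partner of \<open>w\<^sub>h\<close> and that of \<open>m\<^sub>g\<close> when \<open>h = g a\<^sub>i\<close>; hence both \<open>K a\<^sub>b\<close> and \<open>K a\<^sub>b\<^sub>-\<^sub>1\<close> are contained
  in \<open>L\<close>. All three sets have the cardinality of \<open>K\<close>, so \<open>K q\<^sub>b = K\<close>, and \<open>K\<close> is trivial
  when \<open>q\<^sub>b\<close> generates the group. If this holds for every \<open>b\<close>, then \<open>d\<close> is constant.
  Conversely, \<open>K q\<^sub>b = K\<close> makes \<open>\<mu>\<close> with indices \<open>b\<close> on \<open>K\<close> and \<open>b - 1\<close> off \<open>K\<close> surjective, and no \<open>i\<close> fits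
  strictly between two indices that differ by at most \<open>1\<close>.
\<close>

section \<open>Preference orders given by lists\<close>

lemma list_pref_nth_iff:
  assumes "distinct xs" "i < length xs" "j < length xs"
  shows "(xs ! i, xs ! j) \<in> list_pref xs \<longleftrightarrow> i < j"
  using assms by (auto simp: list_pref_def nth_eq_iff_index_eq)

lemma list_pref_rev: "list_pref (rev xs) = (list_pref xs)\<inverse>"
proof -
  \<comment> \<open>One inclusion for all lists is enough: reversal is an involution, so the
    instance at \<open>rev xs\<close> is the opposite inclusion.\<close>
  have "list_pref (rev ys) \<subseteq> (list_pref ys)\<inverse>" for ys :: "'a list"
  proof
    fix p assume "p \<in> list_pref (rev ys)"
    then obtain i j where "i < j" "j < length ys" "p = (rev ys ! i, rev ys ! j)"
      by (auto simp: list_pref_def)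
    then have "prod.swap p = (ys ! (length ys - Suc j), ys ! (length ys - Suc i))"
      "length ys - Suc j < length ys - Suc i" "length ys - Suc i < length ys"
      by (auto simp: rev_nth)
    then have "prod.swap p \<in> list_pref ys"
      unfolding list_pref_def by blast
    then show "p \<in> (list_pref ys)\<inverse>" by (cases p) auto
  qed
  from this[of xs] this[of "rev xs"] show ?thesis by auto
qed

section \<open>Right translates of sets and cyclic subgroups\<close>

context group
begin

text \<open>The elements that fix \<open>K\<close> under right translation form a subgroup, so one
  containing \<open>q\<close> contains everything \<open>q\<close> generates.\<close>

lemma r_coset_generate_eq:
  assumes "K \<subseteq> carrier G" "q \<in> carrier G" "K #> q = K" "h \<in> generate G {q}"
  shows "K #> h = K"
  using assms(4)
proof induction
  case one
  then show ?case using assms(1) by (simp add: coset_mult_one)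
next
  case (incl h)
  then show ?case using assms(3) by simp
next
  case (inv h)
  have "K #> q #> inv q = K"
    using assms(1,2) by (simp add: coset_mult_assoc coset_mult_one)
  then show ?case using inv assms(3) by simp
next
  case (eng h1 h2)
  moreover have "h1 \<in> carrier G" "h2 \<in> carrier G"
    using eng.hyps generate_in_carrier[of "{q}"] assms(2) by auto
  ultimately show ?case using assms(1) by (metis coset_mult_assoc)
qed

lemma r_coset_generator_trivial:
  assumes "generate G {q} = carrier G" "q \<in> carrier G" "K \<subseteq> carrier G" "K #> q = K"
  shows "K = {} \<or> K = carrier G"
proof (cases "K = {}")
  case False
  then obtain k where k: "k \<in> K" "k \<in> carrier G" using assms(3) by auto
  have "g \<in> K" if g: "g \<in> carrier G" for g
  proof -
    \<comment> \<open>Right multiplication by \<open>inv k \<otimes> g\<close> carries the known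
      member \<open>k\<close> of \<open>K\<close> to the arbitrary element \<open>g\<close>.\<close>
    have "K #> (inv k \<otimes> g) = K"
      using r_coset_generate_eq[OF assms(3,2,4)] assms(1) k g by simp
    moreover have "k \<otimes> (inv k \<otimes> g) \<in> K #> (inv k \<otimes> g)"
      using k by (auto simp: r_coset_def)
    ultimately show ?thesis using k g by (simp flip: m_assoc)
  qed
  then show ?thesis using assms(3) by auto
qed simp

lemma card_r_coset:
  assumes "K \<subseteq> carrier G" "a \<in> carrier G"
  shows "card (K #> a) = card K"
proof -
  have "K #> a = (\<lambda>x. x \<otimes> a) ` K" by (auto simp: r_coset_def)
  moreover have "inj_on (\<lambda>x. x \<otimes> a) K"
    using assms by (auto intro!: inj_onI simp: subset_iff)
  ultimately show ?thesis by (simp add: card_image)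
qed

lemma carrier_r_coset: "a \<in> carrier G \<Longrightarrow> carrier G #> a = carrier G"
  using coset_join2 subgroup_self by blast

text \<open>A left coset of a subgroup is closed under right multiplication by that subgroup, and so
  is a union of such cosets. Closure under \<open>q\<close> gives one inclusion, closure under
  \<open>inv q\<close> the other.\<close>

lemma union_of_left_cosets_generate:
  assumes "union_of_left_cosets G (generate G {q}) K" "q \<in> carrier G"
  shows "K \<subseteq> carrier G" "K #> q = K"
proof -
  let ?H = "generate G {q}"
  have sub: "subgroup ?H G" using assms(2) by (simp add: generate_is_subgroup)
  obtain C where C: "C \<subseteq> lcosets\<^bsub>G\<^esub> ?H" "K = \<Union>C"
    using assms(1) by (auto simp: union_of_left_cosets_def)
  have Hc: "?H \<subseteq> carrier G" using sub by (rule subgroup.subset)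
  show K: "K \<subseteq> carrier G"
  proof
    fix x assume "x \<in> K"
    then obtain a where "a \<in> carrier G" "x \<in> a <# ?H"
      using C by (auto simp: LCOSETS_def)
    then show "x \<in> carrier G" using l_coset_subset_G[OF Hc] by blast
  qed
  have closed: "x \<otimes> h \<in> K" if x: "x \<in> K" and h: "h \<in> ?H" for x h
  proof -
    obtain X where X: "X \<in> C" "x \<in> X" using x C by auto
    then obtain a where a: "a \<in> carrier G" "a <# ?H \<in> C" "x \<in> a <# ?H"
      using C by (auto simp: LCOSETS_def)
    then obtain h' where h': "h' \<in> ?H" "x = a \<otimes> h'" by (auto simp: l_coset_def)
    then have "x \<otimes> h = a \<otimes> (h' \<otimes> h)" "h' \<otimes> h \<in> ?H"
      using h h' a(1) Hc sub by (auto simp: m_assoc subgroup.m_closed subset_iff)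
    then have "x \<otimes> h \<in> a <# ?H" by (auto simp: l_coset_def)
    then show ?thesis using a C by auto
  qed
  have q: "q \<in> ?H" "inv q \<in> ?H" by (auto intro: generate.incl generate.inv)
  show "K #> q = K"
  proof (intro subset_antisym subsetI)
    fix x assume "x \<in> K #> q"
    then show "x \<in> K" using closed q by (auto simp: r_coset_def)
  next
    fix x assume x: "x \<in> K"
    then have "(x \<otimes> inv q) \<otimes> q = x"
      using K assms(2) by (auto simp: m_assoc)
    moreover have "(x \<otimes> inv q) \<otimes> q \<in> K #> q"
      using closed[OF x q(2)] by (auto simp: r_coset_def)
    ultimately show "x \<in> K #> q" by simp
  qed
qed

end

section \<open>The template in terms of indices\<close>

locale group_ordering = group G for G :: "('a, 'b) monoid_scheme" (structure) +
  fixes A :: "'a list"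
  assumes ordering: "is_ordering G A"
begin

lemma distinct_A: "distinct A" and set_A: "set A = carrier G"
  using ordering by (auto simp: is_ordering_def)

lemma finite_carrier: "finite (carrier G)"
  using set_A by (metis List.finite_set)

lemma length_A: "length A = order G"
  using distinct_A set_A by (metis distinct_card order_def)

lemma nth_A_closed [simp]: "i < length A \<Longrightarrow> A ! i \<in> carrier G"
  using set_A nth_mem by blast

lemma nth_A_eq_iff: "i < length A \<Longrightarrow> j < length A \<Longrightarrow> A ! i = A ! j \<longleftrightarrow> i = j"
  using distinct_A by (rule nth_eq_iff_index_eq)

lemma carrier_eq_mult_nth:
  assumes "g \<in> carrier G" "h \<in> carrier G"
  obtains i where "i < length A" "h = g \<otimes> A ! i"
proof -
  have "inv g \<otimes> h \<in> set A" using assms set_A by simp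
  then obtain i where i: "i < length A" "A ! i = inv g \<otimes> h"
    by (auto simp: in_set_conv_nth)
  moreover have "h = g \<otimes> (inv g \<otimes> h)"
    using assms by (simp flip: m_assoc)
  ultimately show ?thesis using that by metis
qed

lemma template_simps [simp]:
  "men (template G A) = carrier G" "women (template G A) = carrier G"
  by (simp_all add: template_def)

lemma man_pref_iff:
  assumes "g \<in> carrier G" "i < length A" "j < length A"
  shows "(g \<otimes> A ! i, g \<otimes> A ! j) \<in> man_pref (template G A) g \<longleftrightarrow> i < j"
proof -
  have "distinct (map (\<lambda>a. g \<otimes> a) A)"
    using assms distinct_A set_A by (auto simp: distinct_map inj_on_def)
  from list_pref_nth_iff[OF this, of i j] assms show ?thesis by (simp add: template_def)
qed

text \<open>The man \<open>h \<otimes> inv (A ! i)\<close> is the one whose own list has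
  \<open>h\<close> at index \<open>i\<close>. Reversal makes the larger index better for
  \<open>h\<close>, opposite to the men.\<close>

lemma woman_pref_iff:
  assumes "h \<in> carrier G" "i < length A" "j < length A"
  shows "(h \<otimes> inv (A ! i), h \<otimes> inv (A ! j)) \<in> woman_pref (template G A) h \<longleftrightarrow> j < i"
proof -
  have "distinct (map (\<lambda>a. h \<otimes> inv a) A)"
    using assms distinct_A set_A by (auto simp: distinct_map inj_on_def dest: inv_inj[THEN inj_onD])
  from list_pref_nth_iff[OF this, of j i] assms show ?thesis
    by (simp add: template_def list_pref_rev)
qed

lemma of_index_apply: "g \<in> carrier G \<Longrightarrow> of_index G A d g = g \<otimes> A ! d g"
  by (simp add: of_index_def)

text \<open>The equation \<open>eq\<close> says that \<open>g'\<close> is the partner of the woman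
  in question. The man compares her index \<open>i\<close> with \<open>d g\<close>, and she compares
  the same \<open>i\<close> with \<open>d g'\<close> in the opposite order, so \<open>i\<close> is
  sandwiched.\<close>

lemma blocks_of_index_iff:
  assumes d: "d \<in> carrier G \<rightarrow> {..<length A}"
    and bij: "bij_betw (of_index G A d) (carrier G) (carrier G)"
    and g: "g \<in> carrier G" "g' \<in> carrier G" "i < length A"
    and eq: "g \<otimes> A ! i = g' \<otimes> A ! d g'"
  shows "blocks (template G A) (of_index G A d) g (g \<otimes> A ! i) \<longleftrightarrow> d g' < i \<and> i < d g"
proof -
  let ?h = "g \<otimes> A ! i"
  have dl: "d g < length A" "d g' < length A" using d g by auto
  have "the_inv_into (carrier G) (of_index G A d) ?h = g'"
    using bij g eq by (intro the_inv_into_f_eq) (auto simp: bij_betw_def of_index_apply)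
  moreover have "?h \<otimes> inv (A ! i) = g" using g by (simp add: m_assoc)
  moreover have "?h \<otimes> inv (A ! d g') = g'" unfolding eq using g dl by (simp add: m_assoc)
  moreover have "?h \<in> carrier G" using g by simp
  ultimately have "(g, the_inv_into (carrier G) (of_index G A d) ?h)
      \<in> woman_pref (template G A) ?h \<longleftrightarrow> d g' < i"
    using woman_pref_iff[of ?h i "d g'"] g(3) dl(2) by simp
  then show ?thesis
    using man_pref_iff[OF g(1,3) dl(1)] g(1) by (auto simp: blocks_def of_index_apply)
qed

text \<open>Each woman is \<open>g \<otimes> A ! i\<close> for some \<open>i\<close>, and
  surjectivity supplies her partner \<open>g'\<close>. Plain \<open>\<rightarrow>\<close> instead of
  \<open>\<rightarrow>\<^sub>E\<close> admits constant index functions; \<open>of_index\<close> does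
  the restriction itself.\<close>

lemma of_index_in_Stab_iff:
  assumes d: "d \<in> carrier G \<rightarrow> {..<length A}"
  shows "of_index G A d \<in> Stab (template G A) \<longleftrightarrow>
    bij_betw (of_index G A d) (carrier G) (carrier G) \<and>
    (\<forall>g\<in>carrier G. \<forall>g'\<in>carrier G. \<forall>i<length A.
       g \<otimes> A ! i = g' \<otimes> A ! d g' \<longrightarrow> \<not> (d g' < i \<and> i < d g))"
proof (cases "bij_betw (of_index G A d) (carrier G) (carrier G)")
  case bij: True
  have "(\<exists>g\<in>carrier G. \<exists>h\<in>carrier G. blocks (template G A) (of_index G A d) g h) \<longleftrightarrow>
    (\<exists>g\<in>carrier G. \<exists>g'\<in>carrier G. \<exists>i<length A.
       g \<otimes> A ! i = g' \<otimes> A ! d g' \<and> d g' < i \<and> i < d g)" (is "?L \<longleftrightarrow> ?R")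
  proof
    assume ?L
    then obtain g h where gh: "g \<in> carrier G" "h \<in> carrier G"
      "blocks (template G A) (of_index G A d) g h" by blast
    then obtain i where i: "i < length A" "h = g \<otimes> A ! i" using carrier_eq_mult_nth by metis
    have "h \<in> of_index G A d ` carrier G" using bij gh by (simp add: bij_betw_def)
    then obtain g' where "g' \<in> carrier G" "h = g' \<otimes> A ! d g'"
      by (auto simp: of_index_apply)
    then show ?R using blocks_of_index_iff[OF d bij, of g g' i] gh i by auto
  next
    assume ?R
    then obtain g g' i where "g \<in> carrier G" "g' \<in> carrier G" "i < length A"
      "g \<otimes> A ! i = g' \<otimes> A ! d g'" "d g' < i" "i < d g" by blast
    then show ?L
      using blocks_of_index_iff[OF d bij, of g g' i]
      by (intro bexI[of _ g] bexI[of _ "g \<otimes> A ! i"]) auto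
  qed
  then show ?thesis
    using bij by (auto simp: Stab_def matchings_def of_index_def)
qed (auto simp: Stab_def matchings_def)

lemma Stab_obtain_index:
  assumes "\<mu> \<in> Stab (template G A)"
  obtains d where "d \<in> carrier G \<rightarrow> {..<length A}" "\<mu> = of_index G A d"
proof -
  have \<mu>: "\<mu> \<in> extensional (carrier G)" "bij_betw \<mu> (carrier G) (carrier G)"
    using assms by (auto simp: Stab_def matchings_def)
  have "\<forall>g\<in>carrier G. \<exists>i. i < length A \<and> \<mu> g = g \<otimes> A ! i"
    using \<mu>(2) carrier_eq_mult_nth by (metis bij_betwE)
  then obtain d where d: "\<forall>g\<in>carrier G. d g < length A \<and> \<mu> g = g \<otimes> A ! d g"
    by metis
  then have "\<mu> = of_index G A d"
    using \<mu>(1) by (auto simp: of_index_def extensional_def fun_eq_iff)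
  with d that show ?thesis by auto
qed

section \<open>Canonical matchings\<close>

lemma canonical_eq_of_index: "canonical G A t = of_index G A (\<lambda>_. t)"
  by (simp add: canonical_def of_index_def)

lemma canonical_in_Stab:
  assumes "t < length A"
  shows "canonical G A t \<in> Stab (template G A)"
proof -
  have "(\<lambda>g. g \<otimes> A ! t) ` carrier G = carrier G"
    using carrier_r_coset[of "A ! t"] assms by (auto simp: r_coset_def)
  moreover have "inj_on (\<lambda>g. g \<otimes> A ! t) (carrier G)"
    using assms by (auto intro!: inj_onI)
  ultimately have "bij_betw (of_index G A (\<lambda>_. t)) (carrier G) (carrier G)"
    by (simp add: bij_betw_def of_index_def inj_on_def)
  then show ?thesis
    \<comment> \<open>With constant index, blocking would require \<open>t < i\<close> and
      \<open>i < t\<close>.\<close>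
    using assms unfolding canonical_eq_of_index by (subst of_index_in_Stab_iff) auto
qed

lemma of_index_eq_canonical_iff:
  assumes "d \<in> carrier G \<rightarrow> {..<length A}" "t < length A"
  shows "of_index G A d = canonical G A t \<longleftrightarrow> (\<forall>g\<in>carrier G. d g = t)"
proof
  assume eq: "of_index G A d = canonical G A t"
  show "\<forall>g\<in>carrier G. d g = t"
  proof
    fix g assume g: "g \<in> carrier G"
    then have "g \<otimes> A ! d g = g \<otimes> A ! t"
      using fun_cong[OF eq, of g] by (simp add: of_index_def canonical_def)
    moreover have "d g < length A" using assms(1) g by auto
    ultimately show "d g = t" using g assms(2) nth_A_eq_iff by simp
  qed
qed (auto simp: of_index_def canonical_def)

lemma card_canonical: "card (canonical G A ` {..<length A}) = length A"
proof -
  have "inj_on (canonical G A) {..<length A}"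
  proof (rule inj_onI)
    fix s t assume "s \<in> {..<length A}" "t \<in> {..<length A}" "canonical G A s = canonical G A t"
    then show "s = t"
      \<comment> \<open>The element \<open>\<one>\<close> provides a point of the carrier at which
        the two constants can be compared.\<close>
      using of_index_eq_canonical_iff[of "\<lambda>_. s" t] one_closed
      by (auto simp: canonical_eq_of_index[of s])
  qed
  then show ?thesis by (simp add: card_image)
qed

text \<open>The canonical matchings are \<open>length A\<close> distinct stable ones, so this count
  leaves room for no other. The argument needs a finite stable set, which follows from the
  finiteness of the set of index functions.\<close>

lemma card_Stab_eq_iff:
  "card (Stab (template G A)) = length A \<longleftrightarrow>
   Stab (template G A) = canonical G A ` {..<length A}"
proof -
  have "Stab (template G A) \<subseteq> of_index G A ` (carrier G \<rightarrow>\<^sub>E {..<length A})"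
  proof
    fix \<mu> assume "\<mu> \<in> Stab (template G A)"
    then obtain d where "d \<in> carrier G \<rightarrow> {..<length A}" "\<mu> = of_index G A d"
      by (rule Stab_obtain_index)
    then show "\<mu> \<in> of_index G A ` (carrier G \<rightarrow>\<^sub>E {..<length A})"
      by (intro image_eqI[of _ _ "restrict d (carrier G)"])
        (auto simp: of_index_def restrict_def fun_eq_iff)
  qed
  then have "finite (Stab (template G A))"
    by (rule finite_subset) (simp add: finite_carrier finite_PiE)
  moreover have "canonical G A ` {..<length A} \<subseteq> Stab (template G A)"
    using canonical_in_Stab by auto
  ultimately show ?thesis
    using card_canonical card_subset_eq by metis
qed

section \<open>Upper level sets of a stable index function\<close>

lemma stable_level_set_invariant:
  assumes d: "d \<in> carrier G \<rightarrow> {..<length A}"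
    and stab: "of_index G A d \<in> Stab (template G A)"
    and b: "0 < b" "b < length A"
  defines "K \<equiv> {g \<in> carrier G. b \<le> d g}"
  shows "K #> q_elt G A b = K"
proof -
  let ?\<mu> = "of_index G A d"
  have bij: "bij_betw ?\<mu> (carrier G) (carrier G)"
    and no_block: "\<And>g g' i. \<lbrakk>g \<in> carrier G; g' \<in> carrier G; i < length A;
        g \<otimes> A ! i = g' \<otimes> A ! d g'\<rbrakk> \<Longrightarrow> \<not> (d g' < i \<and> i < d g)"
    using stab of_index_in_Stab_iff[OF d] by blast+
  have K: "K \<subseteq> carrier G" by (auto simp: K_def)
  have card_L: "card (?\<mu> ` K) = card K"
    using bij K by (intro card_image) (auto simp: bij_betw_def intro: inj_on_subset)
  have fin: "finite (?\<mu> ` K)" using K finite_carrier by (auto intro: finite_subset)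
  have eq: "K #> A ! i = ?\<mu> ` K" if i: "i = b \<or> i = b - 1" for i
  proof -
    have il: "i < length A" using i b by auto
    have "K #> A ! i \<subseteq> ?\<mu> ` K"
    proof
      fix h assume "h \<in> K #> A ! i"
      then obtain g where g: "g \<in> K" "h = g \<otimes> A ! i" by (auto simp: r_coset_def)
      have gc: "g \<in> carrier G" "h \<in> carrier G" using g K il by auto
      have "h \<in> ?\<mu> ` carrier G" using bij gc by (simp add: bij_betw_def)
      then obtain g' where g': "g' \<in> carrier G" "h = ?\<mu> g'" by auto
      have eq': "g \<otimes> A ! i = g' \<otimes> A ! d g'" using g g' by (simp add: of_index_apply)
      have same: "g = g'" if "d g' = i"
        using eq' that gc g' il by simp
      have "b \<le> d g" using g by (simp add: K_def)
      have "b \<le> d g'"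
      proof (rule ccontr)
        \<comment> \<open>Now \<open>d g' \<le> b - 1 \<le> i \<le> b \<le> d g\<close>. Equality of
          \<open>i\<close> with either end would force \<open>g = g'\<close>, although
          \<open>d g\<close> and \<open>d g'\<close> lie on different sides of the threshold; so
          both inequalities are strict and the pair blocks.\<close>
        assume lt: "\<not> b \<le> d g'"
        then have "g \<noteq> g'" using \<open>b \<le> d g\<close> by auto
        have ne: "d g \<noteq> i"
        proof
          assume "d g = i"
          then have "?\<mu> g = ?\<mu> g'" using eq' gc g' by (simp add: of_index_apply)
          then have "g = g'" using bij gc g' by (auto simp: bij_betw_def dest: inj_onD)
          with \<open>g \<noteq> g'\<close> show False ..
        qed
        have "d g' < i" using lt i same \<open>g \<noteq> g'\<close> by (cases "d g' = i") auto
        moreover have "i < d g" using i \<open>b \<le> d g\<close> ne by auto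
        ultimately show False using no_block[OF gc(1) g'(1) il eq'] by blast
      qed
      then show "h \<in> ?\<mu> ` K" using g' by (auto simp: K_def)
    qed
    then show ?thesis
      using card_r_coset[OF K, of "A ! i"] il card_L fin by (intro card_subset_eq) auto
  qed
  then have "K #> A ! (b - 1) = K #> A ! b" by simp
  then show ?thesis
    unfolding q_elt_def using K b by (intro coset_mult_inv2) auto
qed

lemma q_elt_closed [simp]: "b < length A \<Longrightarrow> q_elt G A b \<in> carrier G"
  by (simp add: q_elt_def)

text \<open>The level set with threshold \<open>d x\<close> contains \<open>x\<close>; being
  trivial, it is the whole carrier, so \<open>d x\<close> is a lower bound of all indices. As
  \<open>x\<close> is arbitrary, \<open>d\<close> is constant.\<close>

lemma stable_imp_canonical:
  assumes gen: "\<And>b. 0 < b \<Longrightarrow> b < length A \<Longrightarrow> generate G {q_elt G A b} = carrier G"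
    and "\<mu> \<in> Stab (template G A)"
  shows "\<mu> \<in> canonical G A ` {..<length A}"
proof -
  obtain d where d: "d \<in> carrier G \<rightarrow> {..<length A}" "\<mu> = of_index G A d"
    using assms(2) by (rule Stab_obtain_index)
  have le: "d x \<le> d y" if xy: "x \<in> carrier G" "y \<in> carrier G" for x y
  \<comment> \<open>Only a positive threshold has an element \<open>q_elt\<close> that compares it
    with its predecessor; at 0 the bound is immediate.\<close>
  proof (cases "d x = 0")
    case False
    define K where "K = {g \<in> carrier G. d x \<le> d g}"
    have b: "0 < d x" "d x < length A" using False d(1) xy by auto
    then have "K #> q_elt G A (d x) = K"
      unfolding K_def using stable_level_set_invariant d assms(2) by blast
    then have "K = {} \<or> K = carrier G"
      using b gen by (intro r_coset_generator_trivial[of "q_elt G A (d x)"]) (auto simp: K_def)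
    moreover have "x \<in> K" using xy by (simp add: K_def)
    ultimately have "y \<in> K" using xy by auto
    then show ?thesis by (simp add: K_def)
  qed simp
  have t: "d \<one> < length A" using d(1) by auto
  then have "\<mu> = canonical G A (d \<one>)"
    using of_index_eq_canonical_iff[OF d(1)] d(2) le by (auto intro: le_antisym)
  with t show ?thesis by blast
qed

section \<open>Matchings with two adjacent indices\<close>

lemma d_fun_in_PiE: "b < length A \<Longrightarrow> d_fun G b K \<in> carrier G \<rightarrow>\<^sub>E {..<length A}"
  by (auto simp: d_fun_def)

lemma d_fun_in_Pi: "b < length A \<Longrightarrow> d_fun G b K \<in> carrier G \<rightarrow> {..<length A}"
  using d_fun_in_PiE by (simp add: PiE_def)

lemma mu_match_in_Stab:
  assumes b: "b < length A" and K: "union_of_left_cosets G (H_sub G A b) K"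
  shows "mu_match G A b K \<in> Stab (template G A)"
proof -
  let ?\<mu> = "of_index G A (d_fun G b K)"
  have Kc: "K \<subseteq> carrier G" and inv: "K #> q_elt G A b = K"
    using union_of_left_cosets_generate K b by (auto simp: H_sub_def)
  have cl: "A ! (b - 1) \<in> carrier G" using b by simp
  have "K #> A ! (b - 1) = K #> A ! b"
    using inv Kc b unfolding q_elt_def by (intro coset_mult_inv1) auto
  \<comment> \<open>Replacing \<open>K #> A ! b\<close> by the equal translate
    \<open>K #> A ! (b - 1)\<close> turns this image into a translate of the whole carrier.\<close>
  moreover have "?\<mu> ` (K \<union> (carrier G - K)) = (K #> A ! b) \<union> ((carrier G - K) #> A ! (b - 1))"
    unfolding image_Un r_coset_def using Kc
    by (intro arg_cong2[of _ _ _ _ "(\<union>)"]) (auto simp: of_index_def d_fun_def image_iff)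
  moreover have "K \<union> (carrier G - K) = carrier G" using Kc by auto
  moreover have "(K #> A ! (b - 1)) \<union> ((carrier G - K) #> A ! (b - 1)) = carrier G #> A ! (b - 1)"
    using Kc by (auto simp: r_coset_def)
  ultimately have surj: "?\<mu> ` carrier G = carrier G"
    using carrier_r_coset[OF cl] by simp
  \<comment> \<open>A surjective self-map of a finite set is injective.\<close>
  then have "bij_betw ?\<mu> (carrier G) (carrier G)"
    using finite_carrier by (simp add: bij_betw_def eq_card_imp_inj_on)
  then show ?thesis
    unfolding mu_match_def using d_fun_in_Pi[OF b]
    by (subst of_index_in_Stab_iff) (auto simp: d_fun_def)
qed

lemma mu_match_neq_canonical:
  assumes "0 < b" "b < length A" "t < length A" "{} \<subset> K" "K \<subset> carrier G"
  shows "mu_match G A b K \<noteq> canonical G A t"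
proof
  assume "mu_match G A b K = canonical G A t"
  then have eq: "\<forall>g\<in>carrier G. d_fun G b K g = t"
    unfolding mu_match_def using of_index_eq_canonical_iff d_fun_in_Pi assms by simp
  obtain x y where "x \<in> K" "x \<in> carrier G" "y \<in> carrier G" "y \<notin> K" using assms by blast
  with eq have "t = b" "t = b - 1" by (auto simp: d_fun_def)
  \<comment> \<open>For \<open>b > 0\<close> truncated subtraction keeps the two levels
    apart.\<close>
  with assms(1) show False by simp
qed

section \<open>Counting the stable matchings\<close>

lemma card_Stab_iff:
  "card (Stab (template G A)) = length A \<longleftrightarrow>
   (\<forall>b. 0 < b \<and> b < length A \<longrightarrow> generate G {q_elt G A b} = carrier G)"
proof
  assume "\<forall>b. 0 < b \<and> b < length A \<longrightarrow> generate G {q_elt G A b} = carrier G"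
  then have "Stab (template G A) \<subseteq> canonical G A ` {..<length A}"
    using stable_imp_canonical by blast
  then show "card (Stab (template G A)) = length A"
    using canonical_in_Stab by (subst card_Stab_eq_iff) blast
next
  assume "card (Stab (template G A)) = length A"
  then have stab: "Stab (template G A) = canonical G A ` {..<length A}"
    by (simp add: card_Stab_eq_iff)
  show "\<forall>b. 0 < b \<and> b < length A \<longrightarrow> generate G {q_elt G A b} = carrier G"
  proof (intro allI impI)
    fix b assume b: "0 < b \<and> b < length A"
    \<comment> \<open>The test set is the subgroup itself: it is one of its own left cosets and
      nonempty, so if it were proper it would give a stable matching that is not canonical.\<close>
    let ?H = "H_sub G A b"
    have H: "subgroup ?H G" unfolding H_sub_def using b by (simp add: generate_is_subgroup)
    have "?H \<in> lcosets\<^bsub>G\<^esub> ?H"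
      using lcos_mult_one[OF subgroup.subset[OF H]] one_closed
      unfolding LCOSETS_def by blast
    then have "union_of_left_cosets G ?H ?H"
      unfolding union_of_left_cosets_def by (intro exI[of _ "{?H}"]) auto
    then have "mu_match G A b ?H \<in> canonical G A ` {..<length A}"
      using mu_match_in_Stab b stab by blast
    then have "\<not> ?H \<subset> carrier G"
      using mu_match_neq_canonical b subgroup.one_closed[OF H] by blast
    then show "generate G {q_elt G A b} = carrier G"
      using subgroup.subset[OF H] by (auto simp: H_sub_def)
  qed
qed

end

theorem theorem5p7:
  fixes G :: "('a, 'b) monoid_scheme" and A :: "'a list" and n :: nat
  assumes "group G"
    and "finite (carrier G)"
    and "n = order G"
    and "is_ordering G A"
  shows "(\<forall>b\<in>{1..n - 1}.
            (\<forall>K. union_of_left_cosets G (H_sub G A b) K \<longrightarrow>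
                 mu_match G A b K \<in> Stab (template G A) \<and>
                 is_index_function G A (mu_match G A b K) (d_fun G b K)) \<and>
            mu_match G A b (carrier G) = canonical G A b \<and>
            mu_match G A b {} = canonical G A (b - 1) \<and>
            (\<forall>K. union_of_left_cosets G (H_sub G A b) K \<and> {} \<subset> K \<and> K \<subset> carrier G \<longrightarrow>
                 (\<forall>t\<in>{0..n - 1}. mu_match G A b K \<noteq> canonical G A t))) \<and>
         (card (Stab (template G A)) = n \<longleftrightarrow>
            (\<forall>b\<in>{1..n - 1}. generate G {q_elt G A b} = carrier G))"
proof -
  interpret group_ordering G A
    using assms by (simp add: group_ordering_def group_ordering_axioms_def)
  have n: "n = length A" using assms(3) length_A by simp
  have index: "is_index_function G A (mu_match G A b K) (d_fun G b K)" if "b < length A" for b K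
    using d_fun_in_PiE[OF that] by (simp add: is_index_function_def mu_match_def of_index_apply)
  have mu: "mu_match G A b (carrier G) = canonical G A b"
    "mu_match G A b {} = canonical G A (b - 1)" for b
    by (auto simp: mu_match_def of_index_def d_fun_def canonical_def)
  \<comment> \<open>Positivity makes \<open>t \<le> n - 1\<close> equivalent to
    \<open>t < n\<close>; with truncated subtraction this would fail at
    \<open>n = 0\<close>.\<close>
  have "length A > 0" using set_A one_closed by (cases A) auto
  then have range: "b \<in> {1..n - 1} \<longleftrightarrow> 0 < b \<and> b < length A" "t \<in> {0..n - 1} \<longleftrightarrow> t < length A"
    for b t
    unfolding n atLeastAtMost_iff by arith+
  show ?thesis
    unfolding Ball_def range
    using mu_match_in_Stab index mu mu_match_neq_canonical card_Stab_iff n by auto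
qed

end
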